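(* Let $G$ be a maximum planar graph with minimum degree $\delta(G)\leq 5$. Then, for any positive integer $j\leq\delta(G)$, $$\alpha_j(G)\leq\frac{2n(G)-4}{\delta(G)-j+1}.$$
   Context: All graphs are simple and finite. $n(G)$ and $m(G)$ denote the numbers of vertices and edges of $G$. A maximum planar graph is a planar graph $G$ with $m(G)=3n(G)-6$. A $j$-independent set is a set $I$ of vertices such that the subgraph induced by $I$ has maximum degree less than $j$; $\alpha_j(G)$ is the cardinality of a largest $j$-independent set of $G$. *)

theory Defs
  imports "HOL-Analysis.Analysis"
begin

text \<open>A graph is given by its vertex set \<open>V\<close> and its set \<open>E\<close> of edges, which are
  two-element subsets of \<open>V\<close>.\<close>

definition simple_graph :: "'a set \<Rightarrow> 'a set set \<Rightarrow> bool" where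
  "simple_graph V E \<longleftrightarrow> finite V \<and> (\<forall>e\<in>E. e \<subseteq> V \<and> card e = 2)"

definition vertex_degree :: "'a set set \<Rightarrow> 'a \<Rightarrow> nat" where
  "vertex_degree E v = card {e \<in> E. v \<in> e}"

text \<open>Unspecified for the graph without vertices, which is not a maximum planar graph.\<close>

definition min_degree :: "'a set \<Rightarrow> 'a set set \<Rightarrow> nat" where
  "min_degree V E = Min (vertex_degree E ` V)"

text \<open>The inserted 0 only matters for the graph without vertices, whose maximum degree is
  taken to be 0.\<close>

definition max_degree :: "'a set \<Rightarrow> 'a set set \<Rightarrow> nat" where
  "max_degree V E = Max (insert 0 (vertex_degree E ` V))"

definition induced_edges :: "'a set set \<Rightarrow> 'a set \<Rightarrow> 'a set set" where
  "induced_edges E I = {e \<in> E. e \<subseteq> I}"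

definition j_independent :: "'a set \<Rightarrow> 'a set set \<Rightarrow> nat \<Rightarrow> 'a set \<Rightarrow> bool" where
  "j_independent V E j I \<longleftrightarrow> I \<subseteq> V \<and> max_degree I (induced_edges E I) < j"

definition j_independence_number :: "nat \<Rightarrow> 'a set \<Rightarrow> 'a set set \<Rightarrow> nat" where
  "j_independence_number j V E = Max (card ` {I. j_independent V E j I})"

text \<open>A drawing places the vertices at distinct points \<open>p v\<close> of the plane and each edge \<open>e\<close>
  along a simple arc \<open>\<gamma> e\<close> joining its two ends. An arc meets no vertex other than its ends, and
  two distinct arcs meet only in the point of a common end, if there is one.\<close>

definition plane_drawing ::
    "'a set \<Rightarrow> 'a set set \<Rightarrow> ('a \<Rightarrow> complex) \<Rightarrow> ('a set \<Rightarrow> real \<Rightarrow> complex) \<Rightarrow> bool" where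
  "plane_drawing V E p \<gamma> \<longleftrightarrow>
     inj_on p V \<and>
     (\<forall>e\<in>E. arc (\<gamma> e) \<and> {pathstart (\<gamma> e), pathfinish (\<gamma> e)} = p ` e \<and>
             path_image (\<gamma> e) \<inter> p ` V = p ` e) \<and>
     (\<forall>e\<in>E. \<forall>f\<in>E. e \<noteq> f \<longrightarrow> path_image (\<gamma> e) \<inter> path_image (\<gamma> f) = p ` (e \<inter> f))"

definition planar :: "'a set \<Rightarrow> 'a set set \<Rightarrow> bool" where
  "planar V E \<longleftrightarrow> (\<exists>p \<gamma>. plane_drawing V E p \<gamma>)"

definition maximum_planar :: "'a set \<Rightarrow> 'a set set \<Rightarrow> bool" where
  "maximum_planar V E \<longleftrightarrow> planar V E \<and> int (card E) = 3 * int (card V) - 6"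

end

theory Submission
  imports Defs
begin

text \<open>Let \<open>I\<close> be a \<open>j\<close>-independent set. A vertex of \<open>I\<close> has fewer than \<open>j\<close> neighbours in \<open>I\<close>,
  hence more than \<open>\<delta>(G) - j\<close> neighbours outside \<open>I\<close>, so there are at least
  \<open>(\<delta>(G) - j + 1) * card I\<close> edges between \<open>I\<close> and its complement (lemma
  \<open>j_independent_edge_count\<close>). These edges form a bipartite planar graph, and a planar graph
  without triangles on \<open>n \<ge> 3\<close> vertices has at most \<open>2 * n - 4\<close> edges (theorem
  \<open>planar_triangle_free_edges\<close>). This is the bound.

  The second fact is usually read off Euler's formula by counting the sides of the faces. Since the
  edges are arbitrary arcs, faces and their boundary walks are awkward; they are avoided by
  working with cycles only. A graph that falls into two parts with at most one common vertex
  inherits the bound from the parts. In a graph that does not, the central claim is that a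
  cycle \<open>C\<close> with \<open>m\<close> edges and \<open>n\<close> vertices drawn strictly inside satisfies
  \<open>2 * m + 4 \<le> 4 * n + card C\<close> (lemma \<open>inner_edges_bound\<close>). It is proved by induction on \<open>m\<close>: if
  some edge lies inside, then there is an ear inside, that is, a path which meets \<open>C\<close> just in its
  two distinct ends, and it splits the inside of \<open>C\<close> into the insides of two cycles.
  Finally there is a cycle with every other edge inside (lemma \<open>outer_cycle\<close>): if an edge lies
  outside \<open>C\<close>, then there is an ear outside \<open>C\<close>, and by Janiszewski's theorem a part of \<open>C\<close> can
  be replaced by the ear so that the new cycle encloses the old one (lemma
  \<open>theta_some_arc_inside\<close>).\<close>

section \<open>Paths and cycles as edge sets\<close>

text \<open>A path is recorded by its edge set and its two ends, because only the union of the arcs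
  of its edges and the set of its vertices matter below.\<close>

inductive edge_path :: "'a set set \<Rightarrow> 'a \<Rightarrow> 'a set set \<Rightarrow> 'a \<Rightarrow> bool" for E where
  single: "{a, b} \<in> E \<Longrightarrow> a \<noteq> b \<Longrightarrow> edge_path E a {{a, b}} b"
| extend: "{a, b} \<in> E \<Longrightarrow> edge_path E b F c \<Longrightarrow> a \<notin> \<Union>F \<Longrightarrow> edge_path E a (insert {a, b} F) c"

lemma edge_path_subset: "edge_path E a F b \<Longrightarrow> F \<subseteq> E"
  by (induction rule: edge_path.induct) auto

lemma edge_path_ends: "edge_path E a F b \<Longrightarrow> a \<in> \<Union>F \<and> b \<in> \<Union>F \<and> a \<noteq> b"
  by (induction rule: edge_path.induct) auto

lemma edge_path_nonempty: "edge_path E a F b \<Longrightarrow> F \<noteq> {}"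
  by (induction rule: edge_path.induct) auto

lemma edge_path_mono: "edge_path E a F b \<Longrightarrow> E \<subseteq> E' \<Longrightarrow> edge_path E' a F b"
  by (induction rule: edge_path.induct) (auto intro: edge_path.intros)

lemma edge_path_finite: "edge_path E a F b \<Longrightarrow> finite F"
  by (induction rule: edge_path.induct) auto

lemma edge_path_finite_vertices: "edge_path E a F b \<Longrightarrow> finite (\<Union>F)"
  by (induction rule: edge_path.induct) auto

lemma edge_path_card: "edge_path E a F b \<Longrightarrow> card (\<Union>F) = Suc (card F)"
proof (induction rule: edge_path.induct)
  case (extend a b F c)
  have b: "b \<in> \<Union>F" using edge_path_ends[OF extend(2)] by blast
  then have "\<Union>(insert {a, b} F) = insert a (\<Union>F)" by auto
  moreover note edge_path_finite[OF extend(2)] edge_path_finite_vertices[OF extend(2)]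
  moreover have "{a, b} \<notin> F" using extend(3) by auto
  ultimately show ?case using extend by simp
qed auto

lemma edge_path_join:
  assumes "edge_path E a F b" "edge_path E b G c" "\<Union>F \<inter> \<Union>G = {b}"
  shows "edge_path E a (F \<union> G) c"
  using assms
proof (induction rule: edge_path.induct)
  case (single a b)
  then have "a \<notin> \<Union>G" by blast
  then show ?case using edge_path.extend[OF single(1,3)] by simp
next
  case (extend a b F d)
  have d: "d \<in> \<Union>F" "b \<in> \<Union>F" using edge_path_ends[OF extend(2)] by blast+
  have "\<Union>F \<inter> \<Union>G = {d}"
  proof -
    have "d \<in> \<Union>G" using edge_path_ends[OF extend.prems(1)] by blast
    moreover have "\<Union>F \<inter> \<Union>G \<subseteq> {d}" using extend.prems(2) by auto
    ultimately show ?thesis using d(1) by blast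
  qed
  then have p: "edge_path E b (F \<union> G) c" using extend by simp
  have "a \<noteq> d" using d extend(3) by blast
  then have "a \<notin> \<Union>G" using extend.prems(2) by auto
  then have "a \<notin> \<Union>(F \<union> G)" using extend(3) by simp
  then show ?case using edge_path.extend[OF extend(1) p] by simp
qed

lemma edge_path_reverse: "edge_path E a F b \<Longrightarrow> edge_path E b F a"
proof (induction rule: edge_path.induct)
  case (single a b)
  then show ?case using edge_path.single[of b a E] by (simp add: insert_commute)
next
  case (extend a b F c)
  have b: "b \<in> \<Union>F" using edge_path_ends[OF extend(2)] by auto
  have "a \<noteq> b" using b extend(3) by blast
  then have e: "edge_path E b {{a, b}} a"
    using edge_path.single[of b a E] extend(1) by (simp add: insert_commute)
  have "\<Union>F \<inter> \<Union>{{a, b}} = {b}" using b extend(3) by auto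
  then show ?case using edge_path_join[OF extend.IH e] by simp
qed

lemma edge_path_split:
  assumes "edge_path E a F b" "u \<in> \<Union>F" "u \<noteq> a" "u \<noteq> b"
  obtains F1 F2 where "F = F1 \<union> F2" "edge_path E a F1 u" "edge_path E u F2 b"
    "\<Union>F1 \<inter> \<Union>F2 = {u}" "F1 \<inter> F2 = {}"
proof -
  have "\<exists>F1 F2. F = F1 \<union> F2 \<and> edge_path E a F1 u \<and> edge_path E u F2 b \<and>
      \<Union>F1 \<inter> \<Union>F2 = {u} \<and> F1 \<inter> F2 = {}"
    using assms
  proof (induction rule: edge_path.induct)
    case (single a b)
    then show ?case by auto
  next
    case (extend a b F c)
    have b: "b \<in> \<Union>F" using edge_path_ends[OF extend(2)] by auto
    show ?case
    proof (cases "u = b")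
      case True
      have "a \<noteq> b" using b extend(3) by blast
      then have "edge_path E a {{a, b}} b" using extend(1) edge_path.single by metis
      moreover have "\<Union>{{a, b}} \<inter> \<Union>F = {b}" "{{a, b}} \<inter> F = {}" using b extend(3) by auto
      ultimately show ?thesis using True extend(2)
        by (intro exI[of _ "{{a, b}}"] exI[of _ F]) simp
    next
      case False
      then have "u \<in> \<Union>F" using extend.prems by auto
      then obtain F1 F2 where F: "F = F1 \<union> F2" "edge_path E b F1 u" "edge_path E u F2 c"
        "\<Union>F1 \<inter> \<Union>F2 = {u}" "F1 \<inter> F2 = {}"
        using extend.IH False extend.prems(3) by blast
      have b1: "b \<in> \<Union>F1" using edge_path_ends[OF F(2)] by blast
      have "b \<notin> \<Union>F2" using b1 F(4) False by (metis IntI singletonD)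
      moreover have a2: "a \<notin> \<Union>F2" "a \<notin> \<Union>F1" using extend(3) F(1) by simp_all
      ultimately have "\<Union>(insert {a, b} F1) \<inter> \<Union>F2 = {u}"
        using F(4) by (simp add: Int_Un_distrib2)
      moreover have "insert {a, b} F1 \<inter> F2 = {}" using F(5) a2(1) by auto
      moreover have "edge_path E a (insert {a, b} F1) u"
        using edge_path.extend[OF extend(1) F(2)] a2(2) .
      ultimately show ?thesis using F(1,3)
        by (intro exI[of _ "insert {a, b} F1"] exI[of _ F2]) simp
    qed
  qed
  then show ?thesis using that by blast
qed

lemma edge_path_if_connected:
  assumes "(a, b) \<in> {(s, t). {s, t} \<in> E}\<^sup>*" "a \<noteq> b"
  shows "\<exists>F. edge_path E a F b"
  using assms
proof (induction rule: converse_rtrancl_induct)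
  case (step a c)
  have e: "{a, c} \<in> E" using step by simp
  show ?case
  proof (cases "c = b")
    case True
    then show ?thesis using e step.prems edge_path.single by metis
  next
    case False
    then obtain F where F: "edge_path E c F b" using step.IH by auto
    show ?thesis
    proof (cases "a \<in> \<Union>F")
      case True
      show ?thesis
      proof (cases "a = c")
        case True
        then show ?thesis using F by auto
      next
        case False
        then show ?thesis using edge_path_split[OF F True] step.prems by metis
      qed
    next
      case False
      then show ?thesis using edge_path.extend[OF e F] by auto
    qed
  qed
qed simp

text \<open>Disjointness of the edge sets keeps a single edge from counting as a cycle with two equal
  arcs.\<close>

definition cycle_arcs :: "'a set set \<Rightarrow> 'a set set \<Rightarrow> 'a set set \<Rightarrow> 'a \<Rightarrow> 'a \<Rightarrow> bool" where
  "cycle_arcs E F G a b \<longleftrightarrow> edge_path E a F b \<and> edge_path E a G b \<and> F \<inter> G = {} \<and>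
     \<Union>F \<inter> \<Union>G = {a, b}"

definition is_cycle :: "'a set set \<Rightarrow> 'a set set \<Rightarrow> bool" where
  "is_cycle E C \<longleftrightarrow> (\<exists>F G a b. C = F \<union> G \<and> cycle_arcs E F G a b)"

lemma cycle_arcs_swap: "cycle_arcs E F G a b \<Longrightarrow> cycle_arcs E G F a b"
  unfolding cycle_arcs_def by auto

lemma cycle_arcs_reverse: "cycle_arcs E F G a b \<Longrightarrow> cycle_arcs E F G b a"
  unfolding cycle_arcs_def by (auto intro: edge_path_reverse)

lemma cycle_arcs_move_end:
  assumes c: "cycle_arcs E F G a b" and u: "u \<in> \<Union>(F \<union> G)" "u \<noteq> b"
  obtains F' G' where "F \<union> G = F' \<union> G'" "cycle_arcs E F' G' u b"
proof -
  have *: "\<exists>F' G'. F \<union> G = F' \<union> G' \<and> cycle_arcs E F' G' u b"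
    if c: "cycle_arcs E F G a b" and u: "u \<in> \<Union>F" "u \<noteq> a" "u \<noteq> b" for F G
  proof -
    have F: "edge_path E a F b" and G: "edge_path E a G b" and d: "F \<inter> G = {}"
      and i: "\<Union>F \<inter> \<Union>G = {a, b}"
      using c unfolding cycle_arcs_def by auto
    obtain F1 F2 where s: "F = F1 \<union> F2" "edge_path E a F1 u" "edge_path E u F2 b"
      "\<Union>F1 \<inter> \<Union>F2 = {u}" "F1 \<inter> F2 = {}"
      using edge_path_split[OF F u] by metis
    define X Y Z where "X = \<Union>F1" and "Y = \<Union>F2" and "Z = \<Union>G"
    note defs = X_def[symmetric] Y_def[symmetric] Z_def[symmetric]
    have e: "a \<in> X" "b \<in> Y" "u \<in> X" "u \<in> Y" "a \<in> Z" "b \<in> Z"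
      using edge_path_ends[OF s(2)] edge_path_ends[OF s(3)] edge_path_ends[OF G]
      unfolding X_def Y_def Z_def by auto
    have sX: "X \<inter> Y = {u}" and sZ: "(X \<union> Y) \<inter> Z = {a, b}"
      using s(1,4) i unfolding X_def Y_def Z_def by auto
    have nb: "b \<notin> X" "a \<notin> Y" using e(1,2) sX u(2,3) by (metis IntI singletonD)+
    have "X \<inter> Z = {a}" using sZ e nb by blast
    then have "edge_path E u (F1 \<union> G) b"
      using edge_path_join[OF edge_path_reverse[OF s(2)] G] unfolding defs by simp
    moreover have "Y \<inter> (X \<union> Z) = {u, b}" using sX sZ e nb by blast
    then have "\<Union>F2 \<inter> \<Union>(F1 \<union> G) = {u, b}" unfolding X_def Y_def Z_def by simp
    moreover have "F2 \<inter> (F1 \<union> G) = {}" using s d by blast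
    ultimately show ?thesis using s(1,3) unfolding cycle_arcs_def
      by (intro exI[of _ F2] exI[of _ "F1 \<union> G"]) auto
  qed
  have "\<exists>F' G'. F \<union> G = F' \<union> G' \<and> cycle_arcs E F' G' u b"
  proof (cases "u = a")
    case True
    then show ?thesis using c by blast
  next
    case False
    then show ?thesis
      using *[OF c _ False u(2)] *[OF cycle_arcs_swap[OF c] _ False u(2)] u(1)
      by (metis Un_iff Union_Un_distrib sup_commute)
  qed
  then show ?thesis using that by blast
qed

lemma is_cycle_arcs:
  assumes "is_cycle E C" "u \<in> \<Union>C" "v \<in> \<Union>C" "u \<noteq> v"
  obtains F G where "C = F \<union> G" "cycle_arcs E F G u v"
proof -
  obtain F G a b where C: "C = F \<union> G" "cycle_arcs E F G a b"
    using assms(1) unfolding is_cycle_def by blast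
  have "\<exists>w F G. C = F \<union> G \<and> cycle_arcs E F G w v"
  proof (cases "v = b")
    case True
    then show ?thesis using C by blast
  next
    case False
    obtain F' G' where "C = F' \<union> G'" "cycle_arcs E F' G' v b"
      using cycle_arcs_move_end[OF C(2), of v] C(1) assms(3) False by metis
    then show ?thesis using cycle_arcs_reverse by metis
  qed
  then obtain w F G where w: "C = F \<union> G" "cycle_arcs E F G w v" by blast
  obtain F' G' where "C = F' \<union> G'" "cycle_arcs E F' G' u v"
    using cycle_arcs_move_end[OF w(2), of u] w(1) assms(2,4) by metis
  then show ?thesis using that by blast
qed

lemma is_cycleI: "cycle_arcs E F G a b \<Longrightarrow> is_cycle E (F \<union> G)"
  unfolding is_cycle_def by blast

lemma is_cycle_subset: "is_cycle E C \<Longrightarrow> C \<subseteq> E"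
  unfolding is_cycle_def cycle_arcs_def by (auto dest: edge_path_subset)

lemma is_cycle_card_vertices:
  assumes "is_cycle E C"
  shows "card (\<Union>C) = card C"
proof -
  obtain F G a b where C: "C = F \<union> G" and F: "edge_path E a F b" and G: "edge_path E a G b"
    and d: "F \<inter> G = {}" and i: "\<Union>F \<inter> \<Union>G = {a, b}"
    using assms unfolding is_cycle_def cycle_arcs_def by auto
  have "a \<noteq> b" using edge_path_ends[OF F] by blast
  then have "card (\<Union>F) + card (\<Union>G) = card (\<Union>C) + 2"
    using card_Un_Int[OF edge_path_finite_vertices[OF F] edge_path_finite_vertices[OF G]] i C
    by (simp add: Union_Un_distrib)
  moreover have "card C = card F + card G"
    using card_Un_disjoint[OF _ _ d] edge_path_finite[OF F] edge_path_finite[OF G] C by auto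
  ultimately show ?thesis using edge_path_card[OF F] edge_path_card[OF G] by auto
qed

definition triangle_free :: "'a set set \<Rightarrow> bool" where
  "triangle_free E \<longleftrightarrow> (\<forall>a b c. \<not> ({a, b} \<in> E \<and> {b, c} \<in> E \<and> {a, c} \<in> E))"

lemma edge_path_card_1:
  assumes "edge_path E a F b" "card F = 1"
  shows "F = {{a, b}}"
  using assms
proof (cases rule: edge_path.cases)
  case (extend c F')
  have "{a, c} \<notin> F'" using extend by auto
  then have "card F = Suc (card F')" using extend edge_path_finite[OF extend(3)] by simp
  then have "F' = {}" using assms(2) edge_path_finite[OF extend(3)] by simp
  then show ?thesis using edge_path_nonempty[OF extend(3)] by simp
qed simp

lemma edge_path_card_2:
  assumes "edge_path E a F b" "card F = 2"
  shows "\<exists>c. {a, c} \<in> E \<and> {c, b} \<in> E"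
  using assms
proof (cases rule: edge_path.cases)
  case (extend c F')
  have "{a, c} \<notin> F'" using extend by auto
  then have "card F = Suc (card F')" using extend edge_path_finite[OF extend(3)] by simp
  then have "F' = {{c, b}}" using assms(2) edge_path_card_1[OF extend(3)] by simp
  then show ?thesis using edge_path_subset[OF extend(3)] extend(2) by auto
qed simp

lemma triangle_free_cycle_card:
  assumes "is_cycle E C" "triangle_free E"
  shows "4 \<le> card C"
proof (rule ccontr)
  assume "\<not> 4 \<le> card C"
  obtain F G a b where C: "C = F \<union> G" and F: "edge_path E a F b" and G: "edge_path E a G b"
    and d: "F \<inter> G = {}"
    using assms unfolding is_cycle_def cycle_arcs_def by auto
  have "card C = card F + card G"
    using card_Un_disjoint[OF _ _ d] edge_path_finite[OF F] edge_path_finite[OF G] C by auto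
  moreover have "card F > 0" "card G > 0"
    using edge_path_finite[OF F] edge_path_finite[OF G] edge_path_nonempty[OF F]
      edge_path_nonempty[OF G] by (auto simp: card_gt_0_iff)
  ultimately consider "card F = 1" "card G = 1" | "card F = 1" "card G = 2" | "card F = 2" "card G = 1"
    using \<open>\<not> 4 \<le> card C\<close> by linarith
  then show False
  proof cases
    case 1
    then show ?thesis using edge_path_card_1[OF F] edge_path_card_1[OF G] d by auto
  next
    case 2
    then show ?thesis
      using edge_path_card_1[OF F] edge_path_card_2[OF G] edge_path_subset[OF F] assms(2)
      unfolding triangle_free_def by blast
  next
    case 3
    then show ?thesis
      using edge_path_card_1[OF G] edge_path_card_2[OF F] edge_path_subset[OF G] assms(2)
      unfolding triangle_free_def by blast
  qed
qed

section \<open>Ears in graphs without a cut vertex\<close>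

text \<open>For a graph with at least three vertices this means having a cut vertex or being
  disconnected.\<close>

definition separable :: "'a set \<Rightarrow> 'a set set \<Rightarrow> bool" where
  "separable V E \<longleftrightarrow> (\<exists>A B. A \<union> B = V \<and> card (A \<inter> B) \<le> 1 \<and> 2 \<le> card A \<and> 2 \<le> card B \<and>
     (\<forall>e\<in>E. e \<subseteq> A \<or> e \<subseteq> B))"

definition linked_avoiding :: "'a set set \<Rightarrow> 'a set \<Rightarrow> 'a \<Rightarrow> 'a set" where
  "linked_avoiding E W x = {(s, t). {s, t} \<in> E \<and> s \<notin> W \<and> t \<notin> W}\<^sup>* `` {x}"

lemma linked_avoiding_notin: "x \<notin> W \<Longrightarrow> u \<in> linked_avoiding E W x \<Longrightarrow> u \<notin> W"
  unfolding linked_avoiding_def by (auto elim: rtranclE)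

lemma linked_avoiding_step:
  "u \<in> linked_avoiding E W x \<Longrightarrow> {u, v} \<in> E \<Longrightarrow> u \<notin> W \<Longrightarrow> v \<notin> W \<Longrightarrow> v \<in> linked_avoiding E W x"
  unfolding linked_avoiding_def by (auto intro: rtrancl_into_rtrancl)

text \<open>If the component \<open>K\<close> of \<open>x\<close> outside \<open>W\<close> had at most one neighbour in \<open>W\<close>, then \<open>K\<close>
  together with that neighbour, or with any vertex of \<open>W\<close> if there is none, could be separated
  from the rest. With two neighbours, a path through \<open>K\<close> joins them.\<close>

lemma nonseparable_ear:
  assumes G: "simple_graph V E" and ns: "\<not> separable V E"
    and W: "W \<subseteq> V" "2 \<le> card W" and x: "x \<in> V" "x \<notin> W"
  obtains a b P where "a \<in> W" "b \<in> W" "a \<noteq> b" "edge_path E a P b"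
    "\<Union>P \<subseteq> linked_avoiding E W x \<union> {a, b}" "{a, b} \<notin> P"
proof -
  define K where "K = linked_avoiding E W x"
  define N where "N = {w \<in> W. \<exists>u\<in>K. {u, w} \<in> E}"
  have fV: "finite V" and edge: "\<And>e. e \<in> E \<Longrightarrow> e \<subseteq> V \<and> card e = 2"
    using G unfolding simple_graph_def by auto
  have KW: "K \<inter> W = {}" using linked_avoiding_notin[OF x(2)] unfolding K_def by blast
  have xK: "x \<in> K" unfolding K_def linked_avoiding_def by auto
  have KV: "K \<subseteq> V"
  proof
    fix u assume "u \<in> K"
    then have "(x, u) \<in> {(s, t). {s, t} \<in> E \<and> s \<notin> W \<and> t \<notin> W}\<^sup>*"
      unfolding K_def linked_avoiding_def by auto
    then show "u \<in> V" by (cases rule: rtranclE) (use x edge in auto)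
  qed
  show ?thesis
  proof (cases "\<exists>a\<in>N. \<exists>b\<in>N. a \<noteq> b")
    case True
    then obtain a b where ab: "a \<in> N" "b \<in> N" "a \<noteq> b" by blast
    define E' where "E' = {e \<in> E. e \<subseteq> K \<union> {a, b} \<and> e \<noteq> {a, b}}"
    let ?R = "{(s, t). {s, t} \<in> E'}"
    obtain u v where uv: "u \<in> K" "{u, a} \<in> E" "v \<in> K" "{v, b} \<in> E" using ab unfolding N_def by auto
    have reach: "(x, w) \<in> ?R\<^sup>*" if "w \<in> K" for w
    proof -
      have "(x, w) \<in> {(s, t). {s, t} \<in> E \<and> s \<notin> W \<and> t \<notin> W}\<^sup>*"
        using that unfolding K_def linked_avoiding_def by auto
      then have "w \<in> K \<and> (x, w) \<in> ?R\<^sup>*"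
      proof (induction rule: rtrancl_induct)
        case base
        then show ?case using xK by auto
      next
        case (step s t)
        then have "t \<in> K" using linked_avoiding_step[of s E W x t] unfolding K_def by auto
        moreover from this have "{s, t} \<in> E'" using step KW ab unfolding E'_def N_def by auto
        ultimately show ?case using step by (auto intro: rtrancl_into_rtrancl)
      qed
      then show ?thesis by simp
    qed
    have sym: "sym (?R\<^sup>*)" by (intro sym_rtrancl) (auto simp: sym_def insert_commute)
    have "u \<notin> W" "v \<notin> W" using uv KW by auto
    then have "{u, a} \<in> E'" "{v, b} \<in> E'" using uv ab unfolding E'_def N_def by auto
    then have "(u, a) \<in> ?R" "(v, b) \<in> ?R" by auto
    then have "(x, a) \<in> ?R\<^sup>*" "(x, b) \<in> ?R\<^sup>*"
      using reach uv by (meson rtrancl_into_rtrancl)+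
    then have "(a, b) \<in> ?R\<^sup>*" using sym by (meson rtrancl_trans symD)
    then obtain P where P: "edge_path E' a P b" using edge_path_if_connected ab(3) by metis
    have "\<Union>P \<subseteq> K \<union> {a, b}" "{a, b} \<notin> P" using edge_path_subset[OF P] unfolding E'_def by auto
    moreover have "edge_path E a P b" using edge_path_mono[OF P] unfolding E'_def by auto
    ultimately show ?thesis using that ab unfolding N_def K_def by auto
  next
    case False
    obtain w where w: "w \<in> W" "N \<subseteq> {w}"
    proof (cases "N = {}")
      case True
      have "W \<noteq> {}" using W(2) by auto
      then show ?thesis using that True by auto
    next
      case ne: False
      then obtain w where w: "w \<in> N" by auto
      then have "N \<subseteq> {w}" using False by auto
      then show ?thesis using that w unfolding N_def by auto
    qed
    have "(K \<union> {w}) \<union> (V - K) = V" using KV w W by auto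
    moreover have "(K \<union> {w}) \<inter> (V - K) = {w}" using w W KW by auto
    then have "card ((K \<union> {w}) \<inter> (V - K)) \<le> 1" by simp
    moreover have "2 \<le> card (K \<union> {w})"
    proof -
      have "{x, w} \<subseteq> K \<union> {w}" using xK by auto
      moreover have "finite (K \<union> {w})" using finite_subset[OF KV fV] by simp
      moreover have "card {x, w} = 2" using x(2) w(1) by (cases "x = w") auto
      ultimately show ?thesis by (metis card_mono)
    qed
    moreover have "2 \<le> card (V - K)"
    proof -
      have "W \<subseteq> V - K" using W KW by auto
      then show ?thesis using card_mono[of "V - K" W] fV W(2) by auto
    qed
    moreover have "e \<subseteq> K \<union> {w} \<or> e \<subseteq> V - K" if e: "e \<in> E" for e
    proof (cases "e \<inter> K = {}")
      case True
      then show ?thesis using edge[OF e] by auto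
    next
      case False
      then obtain s where s: "s \<in> e" "s \<in> K" by auto
      obtain t where t: "e = {s, t}" using edge[OF e] s(1) by (auto simp: card_2_iff)
      have "t \<in> K \<union> {w}"
      proof (cases "t \<in> W")
        case True
        then have "t \<in> N" using s t e unfolding N_def by auto
        then show ?thesis using w by auto
      next
        case False
        then show ?thesis using linked_avoiding_step[of s E W x t] s t e KW unfolding K_def by auto
      qed
      then show ?thesis using s t by auto
    qed
    ultimately have "separable V E" unfolding separable_def by blast
    then show ?thesis using ns by simp
  qed
qed

section \<open>Arcs and theta curves in the plane\<close>

lemma connected_subset_inside:
  assumes "connected S" "S \<inter> K = {}" "S \<inter> inside K \<noteq> {}"
  shows "S \<subseteq> inside K"
proof
  fix y assume y: "y \<in> S"
  obtain x where x: "x \<in> S" "x \<in> inside K" using assms(3) by auto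
  have "connected_component (- K) x y"
    unfolding connected_component_def using assms(1,2) x y by blast
  then show "y \<in> inside K" using inside_same_component x(2) by blast
qed

lemma connected_arc_minus_finish:
  assumes "arc g"
  shows "connected (path_image g - {pathfinish g})"
proof -
  have "inj_on g {0..1}" using assms unfolding arc_def by simp
  then have "path_image g - {pathfinish g} = g ` ({0..1} - {1})"
    unfolding path_image_def pathfinish_def by (subst inj_on_image_set_diff[of g "{0..1}"]) auto
  also have "{0..1} - {1} = {0..<1::real}" by auto
  finally have "path_image g - {pathfinish g} = g ` {0..<1}" .
  moreover have "continuous_on {0..<1} g"
    using arc_imp_path[OF assms] unfolding path_def by (rule continuous_on_subset) auto
  ultimately show ?thesis using connected_continuous_image connected_Ico by metis
qed

lemma arc_pair_closed_curve:
  fixes c d :: "real \<Rightarrow> complex"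
  assumes "arc c" "arc d" "pathstart c = a" "pathfinish c = b" "pathstart d = a" "pathfinish d = b"
    and "path_image c \<inter> path_image d = {a, b}"
  shows "inside (path_image c \<union> path_image d) \<noteq> {}"
    and "open (inside (path_image c \<union> path_image d))"
    and "open (outside (path_image c \<union> path_image d))"
    and "connected (inside (path_image c \<union> path_image d))"
    and "connected (outside (path_image c \<union> path_image d))"
    and "frontier (inside (path_image c \<union> path_image d)) = path_image c \<union> path_image d"
proof -
  have "simple_path (c +++ reversepath d)"
    using assms by (intro simple_path_join_loop) (auto simp: arc_reversepath)
  moreover have "pathfinish (c +++ reversepath d) = pathstart (c +++ reversepath d)"
    using assms by simp
  moreover have "path_image (c +++ reversepath d) = path_image c \<union> path_image d"
    using assms by (simp add: path_image_join)
  ultimately show "inside (path_image c \<union> path_image d) \<noteq> {}"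
    and "open (inside (path_image c \<union> path_image d))"
    and "open (outside (path_image c \<union> path_image d))"
    and "connected (inside (path_image c \<union> path_image d))"
    and "connected (outside (path_image c \<union> path_image d))"
    and "frontier (inside (path_image c \<union> path_image d)) = path_image c \<union> path_image d"
    using Jordan_inside_outside[of "c +++ reversepath d"] by auto
qed

text \<open>The region \<open>D\<close> inside \<open>c1\<close> and \<open>c2\<close> touches \<open>c2\<close>, hence lies on the same side of the
  curve formed by \<open>c1\<close> and \<open>c\<close> as \<open>c2\<close> does.\<close>

lemma theta_inside_subset_outside:
  fixes c c1 c2 :: "real \<Rightarrow> complex"
  assumes c: "arc c" "pathstart c = a" "pathfinish c = b"
    and c1: "arc c1" "pathstart c1 = a" "pathfinish c1 = b"
    and c2: "arc c2" "pathstart c2 = a" "pathfinish c2 = b"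
    and i12: "path_image c1 \<inter> path_image c2 = {a, b}"
    and i1: "path_image c1 \<inter> path_image c = {a, b}"
    and i2: "path_image c2 \<inter> path_image c = {a, b}"
    and out: "path_image c \<inter> inside (path_image c1 \<union> path_image c2) = {}"
    and out2: "path_image c2 \<inter> inside (path_image c1 \<union> path_image c) = {}"
  shows "inside (path_image c1 \<union> path_image c2) \<subseteq> outside (path_image c1 \<union> path_image c)"
proof (rule ccontr)
  let ?D = "inside (path_image c1 \<union> path_image c2)"
  let ?C = "path_image c1 \<union> path_image c"
  note J12 = arc_pair_closed_curve[OF c1(1) c2(1) c1(2,3) c2(2,3) i12]
  note J1 = arc_pair_closed_curve[OF c1(1) c(1) c1(2,3) c(2,3) i1]
  assume no: "\<not> ?D \<subseteq> outside ?C"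
  have disj: "?D \<inter> ?C = {}" using out inside_no_overlap[of "path_image c1 \<union> path_image c2"] by blast
  then have "?D \<inter> inside ?C \<noteq> {}" using no inside_Un_outside[of ?C] by blast
  then have sub: "?D \<subseteq> inside ?C" using connected_subset_inside[OF J12(4) disj] by blast
  obtain z where z: "z \<in> path_image c2" "z \<noteq> a" "z \<noteq> b"
    using nonempty_simple_path_endless[OF arc_imp_simple_path[OF c2(1)]] c2 by auto
  have "z \<notin> ?C" using z i12 i2 by blast
  then have zo: "z \<in> outside ?C" using z(1) out2 inside_Un_outside[of ?C] by blast
  have "z \<in> closure ?D" using J12(6) z(1) unfolding frontier_def by auto
  then have "?D \<inter> outside ?C \<noteq> {}" using J1(3) zo by (metis closure_iff_nhds_not_empty order_refl)
  then show False using sub inside_Int_outside[of ?C] by blast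
qed

text \<open>One of three arcs joining the same two points runs inside the closed curve formed by the
  other two. Otherwise the region inside \<open>c1\<close> and \<open>c2\<close> would be separated from infinity neither
  by \<open>c\<close> and \<open>c1\<close> nor by \<open>c\<close> and \<open>c2\<close>; these two curves share the connected set \<open>c\<close>, so
  Janiszewski's theorem says that their union would not separate it from infinity either.\<close>

lemma theta_some_arc_inside:
  fixes c c1 c2 :: "real \<Rightarrow> complex"
  assumes c: "arc c" "pathstart c = a" "pathfinish c = b"
    and c1: "arc c1" "pathstart c1 = a" "pathfinish c1 = b"
    and c2: "arc c2" "pathstart c2 = a" "pathfinish c2 = b"
    and i12: "path_image c1 \<inter> path_image c2 = {a, b}"
    and i1: "path_image c1 \<inter> path_image c = {a, b}"
    and i2: "path_image c2 \<inter> path_image c = {a, b}"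
    and out: "path_image c \<inter> inside (path_image c1 \<union> path_image c2) = {}"
  shows "path_image c1 \<inter> inside (path_image c2 \<union> path_image c) \<noteq> {} \<or>
    path_image c2 \<inter> inside (path_image c1 \<union> path_image c) \<noteq> {}"
proof (rule ccontr)
  assume "\<not> ?thesis"
  then have o1: "path_image c1 \<inter> inside (path_image c2 \<union> path_image c) = {}"
    and o2: "path_image c2 \<inter> inside (path_image c1 \<union> path_image c) = {}" by auto
  let ?D = "inside (path_image c1 \<union> path_image c2)"
  let ?C1 = "path_image c1 \<union> path_image c" and ?C2 = "path_image c2 \<union> path_image c"
  note J12 = arc_pair_closed_curve[OF c1(1) c2(1) c1(2,3) c2(2,3) i12]
  note J1 = arc_pair_closed_curve[OF c1(1) c(1) c1(2,3) c(2,3) i1]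
  note J2 = arc_pair_closed_curve[OF c2(1) c(1) c2(2,3) c(2,3) i2]
  obtain x where x: "x \<in> ?D" using J12(1) by auto
  have x1: "x \<in> outside ?C1"
    using theta_inside_subset_outside[OF c c1 c2 i12 i1 i2 out o2] x by auto
  have x2: "x \<in> outside ?C2"
    using theta_inside_subset_outside[OF c c2 c1 _ i2 i1 _ o1] x i12 out
    by (auto simp: Un_commute Int_commute)
  have comp: "compact ?C1" "compact ?C2"
    using c(1) c1(1) c2(1) by (auto intro!: compact_Un compact_path_image arc_imp_path)
  then have "bounded (?C1 \<union> ?C2)" using compact_imp_bounded compact_Un by blast
  then obtain y where y: "y \<in> outside (?C1 \<union> ?C2)" using outside_bounded_nonempty by blast
  have y1: "y \<in> outside ?C1" and y2: "y \<in> outside ?C2" and y12: "y \<in> outside (path_image c1 \<union> path_image c2)"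
    using y outside_mono[of ?C1 "?C1 \<union> ?C2"] outside_mono[of ?C2 "?C1 \<union> ?C2"]
      outside_mono[of "path_image c1 \<union> path_image c2" "?C1 \<union> ?C2"] by auto
  have "connected_component (- ?C1) x y"
    unfolding connected_component_def using J1(5) x1 y1 outside_no_overlap[of ?C1] by blast
  moreover have "connected_component (- ?C2) x y"
    unfolding connected_component_def using J2(5) x2 y2 outside_no_overlap[of ?C2] by blast
  moreover have "?C1 \<inter> ?C2 = path_image c" using i12 i1 by blast
  then have "connected (?C1 \<inter> ?C2)" using connected_path_image[OF arc_imp_path[OF c(1)]] by simp
  ultimately have "connected_component (- (?C1 \<union> ?C2)) x y"
    using Janiszewski[OF comp(1) compact_imp_closed[OF comp(2)]] by blast
  then have "connected_component (- (path_image c1 \<union> path_image c2)) x y"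
    by (rule connected_component_of_subset) auto
  then have "y \<in> ?D" using inside_same_component x by blast
  then show False using y12 inside_Int_outside[of "path_image c1 \<union> path_image c2"] by blast
qed

section \<open>The sides of a cycle in a plane graph\<close>

locale plane_graph =
  fixes V :: "'a set" and E :: "'a set set"
    and p :: "'a \<Rightarrow> complex" and \<gamma> :: "'a set \<Rightarrow> real \<Rightarrow> complex"
  assumes simple: "simple_graph V E" and drawing: "plane_drawing V E p \<gamma>"
begin

definition drawn :: "'a set set \<Rightarrow> complex set" where
  "drawn F = (\<Union>e\<in>F. path_image (\<gamma> e))"

definition open_arc :: "'a set \<Rightarrow> complex set" where
  "open_arc e = path_image (\<gamma> e) - p ` e"

definition inner_edges :: "'a set set \<Rightarrow> 'a set set" where
  "inner_edges C = {e \<in> E. open_arc e \<subseteq> inside (drawn C)}"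

definition inner_vertices :: "'a set set \<Rightarrow> 'a set" where
  "inner_vertices C = {v \<in> V. p v \<in> inside (drawn C)}"

lemma finite_V: "finite V"
  using simple unfolding simple_graph_def by simp

lemma edge_subset: "e \<in> E \<Longrightarrow> e \<subseteq> V" and edge_card: "e \<in> E \<Longrightarrow> card e = 2"
  using simple unfolding simple_graph_def by auto

lemma finite_E: "finite E"
  using finite_subset[of E "Pow V"] edge_subset finite_V by auto

lemma inj_p: "inj_on p V"
  and edge_arc: "e \<in> E \<Longrightarrow> arc (\<gamma> e)"
  and edge_ends: "e \<in> E \<Longrightarrow> {pathstart (\<gamma> e), pathfinish (\<gamma> e)} = p ` e"
  and edge_vertices: "e \<in> E \<Longrightarrow> path_image (\<gamma> e) \<inter> p ` V = p ` e"
  and edges_meet: "e \<in> E \<Longrightarrow> f \<in> E \<Longrightarrow> e \<noteq> f \<Longrightarrow> path_image (\<gamma> e) \<inter> path_image (\<gamma> f) = p ` (e \<inter> f)"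
  using drawing unfolding plane_drawing_def by auto

lemma p_in_drawn_iff:
  assumes "F \<subseteq> E" "v \<in> V"
  shows "p v \<in> drawn F \<longleftrightarrow> v \<in> \<Union>F"
proof
  assume "p v \<in> drawn F"
  then obtain e where e: "e \<in> F" "p v \<in> path_image (\<gamma> e)" unfolding drawn_def by auto
  then have "p v \<in> p ` e" using edge_vertices[of e] assms by auto
  then have "v \<in> e" using inj_p edge_subset[of e] e(1) assms by (auto simp: inj_on_def)
  then show "v \<in> \<Union>F" using e by auto
next
  assume "v \<in> \<Union>F"
  then obtain e where e: "e \<in> F" "v \<in> e" by auto
  then have "p v \<in> path_image (\<gamma> e)" using edge_vertices[of e] assms by blast
  then show "p v \<in> drawn F" using e unfolding drawn_def by auto
qed

lemma drawn_Int:
  assumes "F \<subseteq> E" "G \<subseteq> E" "F \<inter> G = {}"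
  shows "drawn F \<inter> drawn G = p ` (\<Union>F \<inter> \<Union>G)"
proof
  show "drawn F \<inter> drawn G \<subseteq> p ` (\<Union>F \<inter> \<Union>G)"
  proof
    fix z assume "z \<in> drawn F \<inter> drawn G"
    then obtain e f where ef: "e \<in> F" "f \<in> G" "z \<in> path_image (\<gamma> e)" "z \<in> path_image (\<gamma> f)"
      unfolding drawn_def by auto
    then have "z \<in> p ` (e \<inter> f)" using edges_meet[of e f] assms by blast
    then show "z \<in> p ` (\<Union>F \<inter> \<Union>G)" using ef by auto
  qed
next
  show "p ` (\<Union>F \<inter> \<Union>G) \<subseteq> drawn F \<inter> drawn G"
  proof
    fix z assume "z \<in> p ` (\<Union>F \<inter> \<Union>G)"
    then obtain v where v: "z = p v" "v \<in> \<Union>F" "v \<in> \<Union>G" by auto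
    then have "v \<in> V" using edge_subset assms by blast
    then show "z \<in> drawn F \<inter> drawn G" using v p_in_drawn_iff assms by auto
  qed
qed

lemma drawn_Un: "drawn (F \<union> G) = drawn F \<union> drawn G"
  unfolding drawn_def by auto

lemma edge_path_vertices: "edge_path E a F b \<Longrightarrow> \<Union>F \<subseteq> V"
  by (intro Union_least edge_subset) (auto dest: edge_path_subset)

lemma edge_oriented_arc:
  assumes "{a, b} \<in> E"
  obtains g where "arc g" "pathstart g = p a" "pathfinish g = p b" "path_image g = path_image (\<gamma> {a, b})"
proof -
  have "{pathstart (\<gamma> {a, b}), pathfinish (\<gamma> {a, b})} = {p a, p b}" using edge_ends[OF assms] by simp
  then consider "pathstart (\<gamma> {a, b}) = p a" "pathfinish (\<gamma> {a, b}) = p b"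
    | "pathstart (\<gamma> {a, b}) = p b" "pathfinish (\<gamma> {a, b}) = p a"
    by (auto simp: doubleton_eq_iff)
  then show ?thesis
    using that[of "\<gamma> {a, b}"] that[of "reversepath (\<gamma> {a, b})"] edge_arc[OF assms]
    by cases (auto simp: arc_reversepath)
qed

lemma edge_path_arc:
  assumes "edge_path E a F b"
  shows "\<exists>g. arc g \<and> pathstart g = p a \<and> pathfinish g = p b \<and> path_image g = drawn F"
  using assms
proof (induction rule: edge_path.induct)
  case (single a b)
  then show ?case using edge_oriented_arc[OF single(1)] unfolding drawn_def by auto
next
  case (extend a b F c)
  obtain h where h: "arc h" "pathstart h = p b" "pathfinish h = p c" "path_image h = drawn F"
    using extend by auto
  obtain g where g: "arc g" "pathstart g = p a" "pathfinish g = p b"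
    "path_image g = path_image (\<gamma> {a, b})"
    using edge_oriented_arc[OF extend(1)] by metis
  have b: "b \<in> \<Union>F" using edge_path_ends[OF extend(2)] by blast
  have "{{a, b}} \<inter> F = {}" using extend(3) by auto
  then have "drawn {{a, b}} \<inter> drawn F = p ` (\<Union>{{a, b}} \<inter> \<Union>F)"
    using drawn_Int[of "{{a, b}}" F] edge_path_subset[OF extend(2)] extend(1) by auto
  also have "\<Union>{{a, b}} \<inter> \<Union>F = {b}" using b extend(3) by auto
  finally have i: "path_image g \<inter> path_image h = {p b}" using g h unfolding drawn_def by simp
  have "arc (g +++ h)" using g h i by (intro arc_join) auto
  moreover have "path_image (g +++ h) = drawn (insert {a, b} F)"
    using g h by (simp add: path_image_join drawn_def)
  ultimately show ?case using g h by (intro exI[of _ "g +++ h"]) simp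
qed

lemma cycle_arcs_curves:
  assumes "cycle_arcs E F G a b"
  obtains g h where "arc g" "pathstart g = p a" "pathfinish g = p b" "path_image g = drawn F"
    "arc h" "pathstart h = p a" "pathfinish h = p b" "path_image h = drawn G"
    "path_image g \<inter> path_image h = {p a, p b}"
proof -
  have F: "edge_path E a F b" and G: "edge_path E a G b" and d: "F \<inter> G = {}"
    and i: "\<Union>F \<inter> \<Union>G = {a, b}"
    using assms unfolding cycle_arcs_def by auto
  have "drawn F \<inter> drawn G = {p a, p b}"
    using drawn_Int[OF edge_path_subset[OF F] edge_path_subset[OF G] d] i by simp
  then show ?thesis using that edge_path_arc[OF F] edge_path_arc[OF G] by metis
qed

lemma open_arc_eq: "e \<in> E \<Longrightarrow> open_arc e = path_image (\<gamma> e) - {pathstart (\<gamma> e), pathfinish (\<gamma> e)}"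
  unfolding open_arc_def using edge_ends by simp

lemma open_arc_connected: "e \<in> E \<Longrightarrow> connected (open_arc e)"
  using open_arc_eq connected_simple_path_endless arc_imp_simple_path edge_arc by metis

lemma open_arc_nonempty: "e \<in> E \<Longrightarrow> open_arc e \<noteq> {}"
  using open_arc_eq nonempty_simple_path_endless arc_imp_simple_path edge_arc by metis

lemma open_arc_disjoint:
  assumes "e \<in> E" "F \<subseteq> E" "e \<notin> F"
  shows "open_arc e \<inter> drawn F = {}"
proof -
  have "drawn {e} \<inter> drawn F = p ` (\<Union>{e} \<inter> \<Union>F)"
    using drawn_Int[of "{e}" F] assms by auto
  then have "path_image (\<gamma> e) \<inter> drawn F \<subseteq> p ` e" unfolding drawn_def by auto
  then show ?thesis unfolding open_arc_def by blast
qed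

lemma open_arc_subset_drawn: "e \<in> F \<Longrightarrow> open_arc e \<subseteq> drawn F"
  unfolding open_arc_def drawn_def by auto

lemma inner_edge_iff_meets:
  assumes "e \<in> E" "C \<subseteq> E"
  shows "e \<in> inner_edges C \<longleftrightarrow> open_arc e \<inter> inside (drawn C) \<noteq> {}"
proof (cases "e \<in> C")
  case True
  then have "open_arc e \<inter> inside (drawn C) = {}"
    using open_arc_subset_drawn inside_no_overlap[of "drawn C"] by blast
  then show ?thesis using open_arc_nonempty[OF assms(1)] unfolding inner_edges_def by blast
next
  case False
  then show ?thesis
    using connected_subset_inside[OF open_arc_connected[OF assms(1)] open_arc_disjoint[OF assms False]]
      open_arc_nonempty[OF assms(1)] assms(1) unfolding inner_edges_def by blast
qed

lemma inner_edges_disjoint_cycle: "C \<subseteq> E \<Longrightarrow> inner_edges C \<inter> C = {}"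
  using inner_edge_iff_meets open_arc_subset_drawn inside_no_overlap[of "drawn C"] by blast

text \<open>An arc without one of its ends is still connected, so an end of an edge that is not on the
  cycle lies on the same side as the edge.\<close>

lemma edge_end_side:
  assumes e: "e \<in> E" "u \<in> e" and C: "C \<subseteq> E" "u \<notin> \<Union>C"
  shows "u \<in> inner_vertices C \<longleftrightarrow> e \<in> inner_edges C"
proof -
  have uV: "u \<in> V" using e edge_subset by auto
  obtain v where v: "e = {u, v}" using edge_card[OF e(1)] e(2) by (auto simp: card_2_iff)
  obtain g where g: "arc g" "pathstart g = p u" "pathfinish g = p v" "path_image g = path_image (\<gamma> e)"
    using edge_oriented_arc e(1) v by metis
  define S where "S = path_image g - {p v}"
  have conn: "connected S" using connected_arc_minus_finish[OF g(1)] g(3) unfolding S_def by simp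
  have "p u \<noteq> p v" using arc_distinct_ends[OF g(1)] g(2,3) by simp
  moreover have "p u \<in> path_image g" using pathstart_in_path_image[of g] g(2) by simp
  ultimately have S: "S = insert (p u) (open_arc e)"
    using g(4) v unfolding S_def open_arc_def by auto
  have "e \<notin> C" using e C by auto
  then have disj: "S \<inter> drawn C = {}"
    using S open_arc_disjoint[OF e(1) C(1)] p_in_drawn_iff[OF C(1) uV] C(2) by simp
  note * = connected_subset_inside[OF conn disj]
  show ?thesis
    using * S open_arc_nonempty[OF e(1)] e(1) uV unfolding inner_edges_def inner_vertices_def by blast
qed

lemma edge_path_inside:
  assumes P: "edge_path E a P b" and C: "C \<subseteq> E" "P \<inter> C = {}" "\<Union>P \<inter> \<Union>C = {a, b}"
    and meets: "drawn P \<inter> inside (drawn C) \<noteq> {}"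
  shows "drawn P - {p a, p b} \<subseteq> inside (drawn C)"
proof -
  have i: "drawn P \<inter> drawn C = {p a, p b}"
    using drawn_Int[OF edge_path_subset[OF P] C(1,2)] C(3) by simp
  obtain g where g: "arc g" "pathstart g = p a" "pathfinish g = p b" "path_image g = drawn P"
    using edge_path_arc[OF P] by auto
  have "connected (drawn P - {p a, p b})"
    using connected_simple_path_endless[OF arc_imp_simple_path[OF g(1)]] g by simp
  moreover have "(drawn P - {p a, p b}) \<inter> drawn C = {}" using i by blast
  moreover have "(drawn P - {p a, p b}) \<inter> inside (drawn C) \<noteq> {}"
    using meets i inside_no_overlap[of "drawn C"] by blast
  ultimately show ?thesis by (rule connected_subset_inside)
qed

lemma linked_avoiding_side:
  assumes C: "C \<subseteq> E" and u: "u \<in> linked_avoiding E (\<Union>C) x"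
  shows "u \<in> inner_vertices C \<longleftrightarrow> x \<in> inner_vertices C"
proof -
  have "(x, u) \<in> {(s, t). {s, t} \<in> E \<and> s \<notin> \<Union>C \<and> t \<notin> \<Union>C}\<^sup>*"
    using u unfolding linked_avoiding_def by simp
  then show ?thesis
  proof (induction rule: rtrancl_induct)
    case (step s t)
    then have st: "{s, t} \<in> E" "s \<notin> \<Union>C" "t \<notin> \<Union>C" by simp_all
    have "s \<in> inner_vertices C \<longleftrightarrow> t \<in> inner_vertices C"
      using edge_end_side[OF st(1) _ C st(2)] edge_end_side[OF st(1) _ C st(3)] by simp
    then show ?case using step.IH by simp
  qed simp
qed

text \<open>Whenever something is drawn on one side of a cycle of a nonseparable graph, there is an ear
  on that side: the edge \<open>f\<close> itself if it is a chord, and otherwise a path through the vertices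
  linked to an end of \<open>f\<close> off the cycle, all of which lie on the side of \<open>f\<close>.\<close>

lemma ear_on_side:
  assumes ns: "\<not> separable V E" and cyc: "is_cycle E C" and f: "f \<in> E" "f \<notin> C"
  obtains a b P where "a \<in> \<Union>C" "b \<in> \<Union>C" "a \<noteq> b" "edge_path E a P b" "P \<inter> C = {}"
    "\<Union>P \<inter> \<Union>C = {a, b}" "f \<in> inner_edges C \<longleftrightarrow> drawn P \<inter> inside (drawn C) \<noteq> {}"
proof (cases "f \<subseteq> \<Union>C")
  case True
  have C: "C \<subseteq> E" using is_cycle_subset[OF cyc] .
  obtain a b where ab: "f = {a, b}" "a \<noteq> b" using edge_card[OF f(1)] by (auto simp: card_2_iff)
  have "p a \<in> drawn C" "p b \<in> drawn C"
    using p_in_drawn_iff[OF C] True ab edge_subset[OF f(1)] by auto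
  then have "p a \<notin> inside (drawn C)" "p b \<notin> inside (drawn C)"
    using inside_no_overlap[of "drawn C"] by blast+
  moreover have "open_arc f = drawn {f} - {p a, p b}" unfolding open_arc_def drawn_def ab(1) by simp
  ultimately have "drawn {f} \<inter> inside (drawn C) = open_arc f \<inter> inside (drawn C)" by blast
  then have side: "f \<in> inner_edges C \<longleftrightarrow> drawn {f} \<inter> inside (drawn C) \<noteq> {}"
    using inner_edge_iff_meets[OF f(1) C] by simp
  have path: "edge_path E a {f} b" using edge_path.single[of a b E] ab f(1) by simp
  have "a \<in> \<Union>C" "b \<in> \<Union>C" using True ab(1) by simp_all
  moreover from this have "\<Union>{f} \<inter> \<Union>C = {a, b}" using ab(1) by simp
  moreover have "{f} \<inter> C = {}" using f(2) by simp
  ultimately show ?thesis using that ab(2) path side by presburger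
next
  case False
  have C: "C \<subseteq> E" using is_cycle_subset[OF cyc] .
  obtain x where x: "x \<in> f" "x \<notin> \<Union>C" using False by auto
  have xV: "x \<in> V" using x f edge_subset by auto
  have WV: "\<Union>C \<subseteq> V" by (intro Union_least edge_subset) (use C in auto)
  have "2 \<le> card (\<Union>C)"
  proof -
    obtain F G a b where c: "C = F \<union> G" "cycle_arcs E F G a b"
      using cyc unfolding is_cycle_def by blast
    then have F: "edge_path E a F b" unfolding cycle_arcs_def by simp
    have "{a, b} \<subseteq> \<Union>C" "a \<noteq> b" using edge_path_ends[OF F] c(1) by simp_all
    then show ?thesis using card_mono[OF finite_subset[OF WV finite_V], of "{a, b}"] by simp
  qed
  then obtain a b P where P: "a \<in> \<Union>C" "b \<in> \<Union>C" "a \<noteq> b" "edge_path E a P b"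
    "\<Union>P \<subseteq> linked_avoiding E (\<Union>C) x \<union> {a, b}" "{a, b} \<notin> P"
    using nonseparable_ear[OF simple ns WV _ xV x(2)] by metis
  note ends = edge_path_ends[OF P(4)]
  have UPC: "\<Union>P \<inter> \<Union>C = {a, b}"
  proof
    show "\<Union>P \<inter> \<Union>C \<subseteq> {a, b}"
    proof
      fix v assume "v \<in> \<Union>P \<inter> \<Union>C"
      then have "v \<in> linked_avoiding E (\<Union>C) x \<union> {a, b}" "v \<in> \<Union>C"
        using subsetD[OF P(5)] by simp_all
      then show "v \<in> {a, b}" using linked_avoiding_notin[OF x(2)] by (metis UnE)
    qed
    show "{a, b} \<subseteq> \<Union>P \<inter> \<Union>C" using ends P(1,2) by simp
  qed
  have edge_in: "\<not> e \<subseteq> {a, b}" if "e \<in> P" for e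
  proof
    assume s: "e \<subseteq> {a, b}"
    have "card e = 2" using that edge_path_subset[OF P(4)] edge_card by auto
    then have "e = {a, b}" using s P(3) by (intro card_subset_eq) auto
    then show False using that P(6) by simp
  qed
  have PC: "P \<inter> C = {}"
  proof (rule ccontr)
    assume "P \<inter> C \<noteq> {}"
    then obtain e where e: "e \<in> P" "e \<in> C" by auto
    then have "e \<subseteq> \<Union>P \<inter> \<Union>C" by auto
    then show False using edge_in[OF e(1)] UPC by simp
  qed
  obtain e where e: "e \<in> P" using edge_path_nonempty[OF P(4)] by auto
  obtain u where u: "u \<in> e" "u \<notin> {a, b}" using edge_in[OF e] by blast
  have uP: "u \<in> \<Union>P" using e u by auto
  then have "u \<in> linked_avoiding E (\<Union>C) x" using P(5) u by blast
  then have side: "u \<in> inner_vertices C \<longleftrightarrow> f \<in> inner_edges C"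
    using linked_avoiding_side[OF C] edge_end_side[OF f(1) x(1) C x(2)] by simp
  have uV: "u \<in> V" using uP edge_path_vertices[OF P(4)] by auto
  have pu: "p u \<in> drawn P" using p_in_drawn_iff[OF edge_path_subset[OF P(4)] uV] uP by simp
  have "p u \<noteq> p a" "p u \<noteq> p b"
    using inj_p u(2) uV P(1,2) WV by (auto simp: inj_on_def)
  then have "f \<in> inner_edges C \<longleftrightarrow> drawn P \<inter> inside (drawn C) \<noteq> {}"
    using edge_path_inside[OF P(4) C PC UPC] pu uV side unfolding inner_vertices_def by blast
  then show ?thesis using that[OF P(1-4) PC UPC] by simp
qed

lemma ear_cycle_arcs:
  assumes c: "cycle_arcs E F G a b" and P: "edge_path E a P b"
    and d: "P \<inter> (F \<union> G) = {}" "\<Union>P \<inter> \<Union>(F \<union> G) = {a, b}"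
  shows "cycle_arcs E F P a b"
proof -
  have F: "edge_path E a F b" using c unfolding cycle_arcs_def by simp
  have "\<Union>F \<inter> \<Union>P = {a, b}"
  proof
    show "\<Union>F \<inter> \<Union>P \<subseteq> {a, b}" using d(2) by auto
    show "{a, b} \<subseteq> \<Union>F \<inter> \<Union>P" using edge_path_ends[OF F] edge_path_ends[OF P] by simp
  qed
  then show ?thesis using F P d(1) unfolding cycle_arcs_def by auto
qed

lemma theta_curves:
  assumes FG: "cycle_arcs E F G a b" and FP: "cycle_arcs E F P a b" and GP: "cycle_arcs E G P a b"
  obtains g h k where "arc g" "pathstart g = p a" "pathfinish g = p b" "path_image g = drawn F"
    "arc h" "pathstart h = p a" "pathfinish h = p b" "path_image h = drawn G"
    "arc k" "pathstart k = p a" "pathfinish k = p b" "path_image k = drawn P"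
    "drawn F \<inter> drawn G = {p a, p b}" "drawn F \<inter> drawn P = {p a, p b}"
    "drawn G \<inter> drawn P = {p a, p b}"
proof -
  have P: "edge_path E a P b" using FP unfolding cycle_arcs_def by simp
  obtain k where "arc k" "pathstart k = p a" "pathfinish k = p b" "path_image k = drawn P"
    using edge_path_arc[OF P] by auto
  moreover obtain g h where "arc g" "pathstart g = p a" "pathfinish g = p b" "path_image g = drawn F"
    "arc h" "pathstart h = p a" "pathfinish h = p b" "path_image h = drawn G"
    "path_image g \<inter> path_image h = {p a, p b}"
    using cycle_arcs_curves[OF FG] by metis
  moreover have "drawn F \<inter> drawn P = {p a, p b}" using cycle_arcs_curves[OF FP] by metis
  moreover have "drawn G \<inter> drawn P = {p a, p b}" using cycle_arcs_curves[OF GP] by metis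
  ultimately show ?thesis using that by metis
qed

lemma theta_split:
  assumes FG: "cycle_arcs E F G a b" and FP: "cycle_arcs E F P a b" and GP: "cycle_arcs E G P a b"
    and P: "drawn P \<inter> inside (drawn (F \<union> G)) \<noteq> {}"
  shows "inside (drawn (F \<union> P)) \<inter> inside (drawn (G \<union> P)) = {}"
    and "inside (drawn (F \<union> P)) \<union> inside (drawn (G \<union> P)) \<union> (drawn P - {p a, p b}) =
      inside (drawn (F \<union> G))"
proof -
  obtain g h k where g: "arc g" "pathstart g = p a" "pathfinish g = p b" "path_image g = drawn F"
    and h: "arc h" "pathstart h = p a" "pathfinish h = p b" "path_image h = drawn G"
    and k: "arc k" "pathstart k = p a" "pathfinish k = p b" "path_image k = drawn P"
    and i: "drawn F \<inter> drawn G = {p a, p b}" "drawn F \<inter> drawn P = {p a, p b}"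
      "drawn G \<inter> drawn P = {p a, p b}"
    using theta_curves[OF FG FP GP] by metis
  have ne: "p a \<noteq> p b" using arc_distinct_ends[OF g(1)] g by simp
  have i': "path_image g \<inter> path_image h = {p a, p b}" "path_image g \<inter> path_image k = {p a, p b}"
    "path_image h \<inter> path_image k = {p a, p b}"
    "path_image k \<inter> inside (path_image g \<union> path_image h) \<noteq> {}"
    using i P g h k by (simp_all add: drawn_Un)
  note s = arc_imp_simple_path
  have "inside (path_image g \<union> path_image k) \<inter> inside (path_image h \<union> path_image k) = {} \<and>
    inside (path_image g \<union> path_image k) \<union> inside (path_image h \<union> path_image k) \<union>
      (path_image k - {p a, p b}) = inside (path_image g \<union> path_image h)"
    using split_inside_simple_closed_curve[OF s[OF g(1)] g(2,3) s[OF h(1)] h(2,3) s[OF k(1)] k(2,3) ne i']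
    by blast
  then show "inside (drawn (F \<union> P)) \<inter> inside (drawn (G \<union> P)) = {}"
    and "inside (drawn (F \<union> P)) \<union> inside (drawn (G \<union> P)) \<union> (drawn P - {p a, p b}) =
      inside (drawn (F \<union> G))"
    using g h k by (simp_all add: drawn_Un)
qed

lemma theta_some_path_inside:
  assumes FG: "cycle_arcs E F G a b" and FP: "cycle_arcs E F P a b" and GP: "cycle_arcs E G P a b"
    and P: "drawn P \<inter> inside (drawn (F \<union> G)) = {}"
  shows "drawn F \<inter> inside (drawn (G \<union> P)) \<noteq> {} \<or> drawn G \<inter> inside (drawn (F \<union> P)) \<noteq> {}"
proof -
  obtain g h k where g: "arc g" "pathstart g = p a" "pathfinish g = p b" "path_image g = drawn F"
    and h: "arc h" "pathstart h = p a" "pathfinish h = p b" "path_image h = drawn G"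
    and k: "arc k" "pathstart k = p a" "pathfinish k = p b" "path_image k = drawn P"
    and i: "drawn F \<inter> drawn G = {p a, p b}" "drawn F \<inter> drawn P = {p a, p b}"
      "drawn G \<inter> drawn P = {p a, p b}"
    using theta_curves[OF FG FP GP] by metis
  show ?thesis
    using theta_some_arc_inside[OF k(1-3) g(1-3) h(1-3)] i P g(4) h(4) k(4)
    by (simp add: drawn_Un)
qed

lemma theta_inner_edges:
  assumes FG: "cycle_arcs E F G a b" and FP: "cycle_arcs E F P a b" and GP: "cycle_arcs E G P a b"
    and P: "drawn P \<inter> inside (drawn (F \<union> G)) \<noteq> {}"
  shows "P \<union> inner_edges (F \<union> P) \<union> inner_edges (G \<union> P) = inner_edges (F \<union> G)"
proof
  note split = theta_split[OF FG FP GP P]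
  have sub: "F \<union> G \<subseteq> E" "F \<union> P \<subseteq> E" "G \<union> P \<subseteq> E"
    using is_cycle_subset[OF is_cycleI[OF FG]] is_cycle_subset[OF is_cycleI[OF FP]]
      is_cycle_subset[OF is_cycleI[OF GP]] by auto
  show "P \<union> inner_edges (F \<union> P) \<union> inner_edges (G \<union> P) \<subseteq> inner_edges (F \<union> G)"
  proof -
    have "e \<in> inner_edges (F \<union> G)" if e: "e \<in> P" for e
    proof -
      have eE: "e \<in> E" using e sub by auto
      have "e \<notin> F \<union> G" using e FP GP unfolding cycle_arcs_def by auto
      then have "open_arc e \<inter> drawn (F \<union> G) = {}" using open_arc_disjoint[OF eE sub(1)] by simp
      moreover have "p a \<in> drawn (F \<union> G)" "p b \<in> drawn (F \<union> G)"
      proof -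
        obtain g where "pathstart g = p a" "pathfinish g = p b" "path_image g = drawn F"
          using theta_curves[OF FG FP GP] by metis
        then show "p a \<in> drawn (F \<union> G)" "p b \<in> drawn (F \<union> G)"
          using pathstart_in_path_image[of g] pathfinish_in_path_image[of g]
          by (simp_all add: drawn_Un)
      qed
      ultimately have "open_arc e \<subseteq> drawn P - {p a, p b}"
        using open_arc_subset_drawn[OF e] by auto
      then have "open_arc e \<subseteq> inside (drawn (F \<union> G))" using split(2) by blast
      then show ?thesis using eE unfolding inner_edges_def by simp
    qed
    then show ?thesis using split(2) unfolding inner_edges_def by blast
  qed
  show "inner_edges (F \<union> G) \<subseteq> P \<union> inner_edges (F \<union> P) \<union> inner_edges (G \<union> P)"
  proof
    fix e assume e: "e \<in> inner_edges (F \<union> G)"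
    then have eE: "e \<in> E" and ein: "open_arc e \<subseteq> inside (drawn (F \<union> G))"
      unfolding inner_edges_def by auto
    show "e \<in> P \<union> inner_edges (F \<union> P) \<union> inner_edges (G \<union> P)"
    proof (cases "e \<in> P")
      case False
      have "P \<subseteq> E" using sub by simp
      then have "open_arc e \<inter> drawn P = {}" using open_arc_disjoint[OF eE] False by simp
      moreover obtain z where "z \<in> open_arc e" using open_arc_nonempty[OF eE] by auto
      ultimately have "open_arc e \<inter> inside (drawn (F \<union> P)) \<noteq> {} \<or>
          open_arc e \<inter> inside (drawn (G \<union> P)) \<noteq> {}"
        using ein split(2) by blast
      then show ?thesis using inner_edge_iff_meets eE sub by auto
    qed simp
  qed
qed

section \<open>Counting edges inside a cycle\<close>

text \<open>Equality holds if all regions inside the cycle are quadrilaterals. An ear of length \<open>l\<close>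
  inside the cycle splits its interior in two: it adds \<open>l\<close> to the number of inner edges,
  \<open>l - 1\<close> to the number of inner vertices and \<open>2 * l\<close> to the total length of the cycles, and the
  two instances of the bound add up exactly. If there is no edge inside, the bound says that the
  cycle has length at least four.\<close>

lemma inner_edges_bound:
  assumes ns: "\<not> separable V E" and tf: "triangle_free E" and cyc: "is_cycle E C"
  shows "2 * card (inner_edges C) + 4 \<le> 4 * card (inner_vertices C) + card C"
  using cyc
proof (induction "card (inner_edges C)" arbitrary: C rule: less_induct)
  case less
  have fin: "finite (inner_edges D)" "finite (inner_vertices D)" for D
    using finite_E finite_V unfolding inner_edges_def inner_vertices_def by auto
  show ?case
  proof (cases "inner_edges C = {}")
    case True
    then show ?thesis using triangle_free_cycle_card[OF less.prems tf] by simp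
  next
    case False
    then obtain f where f: "f \<in> inner_edges C" by auto
    have CE: "C \<subseteq> E" using is_cycle_subset[OF less.prems] .
    then have "f \<in> E" "f \<notin> C" using f inner_edges_disjoint_cycle unfolding inner_edges_def by auto
    then obtain a b P where P: "a \<in> \<Union>C" "b \<in> \<Union>C" "a \<noteq> b" "edge_path E a P b" "P \<inter> C = {}"
      "\<Union>P \<inter> \<Union>C = {a, b}" "drawn P \<inter> inside (drawn C) \<noteq> {}"
      using ear_on_side[OF ns less.prems] f by metis
    obtain F G where C: "C = F \<union> G" and FG: "cycle_arcs E F G a b"
      using is_cycle_arcs[OF less.prems P(1-3)] by metis
    have FP: "cycle_arcs E F P a b" and GP: "cycle_arcs E G P a b"
      using ear_cycle_arcs[OF FG P(4)] ear_cycle_arcs[OF cycle_arcs_swap[OF FG] P(4)] P(5,6) C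
      by (simp_all add: Un_commute)
    have meets: "drawn P \<inter> inside (drawn (F \<union> G)) \<noteq> {}" using P(7) C by simp
    let ?C1 = "F \<union> P" and ?C2 = "G \<union> P"
    have cyc: "is_cycle E ?C1" "is_cycle E ?C2" using is_cycleI[OF FP] is_cycleI[OF GP] by simp_all
    note sub = is_cycle_subset[OF cyc(1)] is_cycle_subset[OF cyc(2)]
    note split = theta_split[OF FG FP GP meets]
    have edges: "P \<union> inner_edges ?C1 \<union> inner_edges ?C2 = inner_edges C"
      using theta_inner_edges[OF FG FP GP meets] C by simp
    have "P \<inter> inner_edges ?C1 = {}" "P \<inter> inner_edges ?C2 = {}"
      using inner_edges_disjoint_cycle[OF sub(1)] inner_edges_disjoint_cycle[OF sub(2)] by auto
    then have "inner_edges ?C1 \<subset> inner_edges C" "inner_edges ?C2 \<subset> inner_edges C"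
      using edges edge_path_nonempty[OF P(4)] by auto
    then have IH: "2 * card (inner_edges ?C1) + 4 \<le> 4 * card (inner_vertices ?C1) + card ?C1"
      "2 * card (inner_edges ?C2) + 4 \<le> 4 * card (inner_vertices ?C2) + card ?C2"
      using less.hyps cyc psubset_card_mono[OF fin(1)] by auto
    have fP: "finite P" "finite (\<Union>P)"
      using edge_path_finite[OF P(4)] edge_path_finite_vertices[OF P(4)] by auto
    have m: "card (inner_edges C) \<le> card P + card (inner_edges ?C1) + card (inner_edges ?C2)"
      unfolding edges[symmetric]
      by (meson add_le_mono1 card_Un_le le_trans)
    have PV: "\<Union>P \<subseteq> V" using edge_path_vertices[OF P(4)] .
    have pP: "p v \<in> drawn P" if "v \<in> \<Union>P" for v
      using p_in_drawn_iff[OF edge_path_subset[OF P(4)]] that PV by auto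
    have d1: "inner_vertices ?C1 \<inter> inner_vertices ?C2 = {}"
      using split(1) unfolding inner_vertices_def by auto
    have d2: "(inner_vertices ?C1 \<union> inner_vertices ?C2) \<inter> (\<Union>P - {a, b}) = {}"
    proof -
      have "p v \<notin> inside (drawn ?C1)" "p v \<notin> inside (drawn ?C2)" if "v \<in> \<Union>P" for v
        using pP[OF that] inside_no_overlap[of "drawn ?C1"] inside_no_overlap[of "drawn ?C2"]
          drawn_Un[of F P] drawn_Un[of G P] by blast+
      then show ?thesis unfolding inner_vertices_def by blast
    qed
    have "inner_vertices ?C1 \<union> inner_vertices ?C2 \<union> (\<Union>P - {a, b}) \<subseteq> inner_vertices C"
    proof -
      have ab: "a \<in> V" "b \<in> V" using PV edge_path_ends[OF P(4)] by auto
      have "v \<in> inner_vertices C" if v: "v \<in> \<Union>P - {a, b}" for v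
      proof -
        have "v \<in> V" using v PV by auto
        moreover from this have "p v \<noteq> p a" "p v \<noteq> p b" using inj_p v ab by (auto simp: inj_on_def)
        ultimately show ?thesis using split(2) pP v C unfolding inner_vertices_def by blast
      qed
      moreover have "inner_vertices ?C1 \<union> inner_vertices ?C2 \<subseteq> inner_vertices C"
        using split(2) C unfolding inner_vertices_def by auto
      ultimately show ?thesis by blast
    qed
    then have "card (inner_vertices ?C1 \<union> inner_vertices ?C2 \<union> (\<Union>P - {a, b})) \<le>
        card (inner_vertices C)"
      by (rule card_mono[OF fin(2)])
    moreover have "card (inner_vertices ?C1 \<union> inner_vertices ?C2 \<union> (\<Union>P - {a, b})) =
        card (inner_vertices ?C1) + card (inner_vertices ?C2) + card (\<Union>P - {a, b})"
      using card_Un_disjoint[OF _ _ d2] card_Un_disjoint[OF fin(2) fin(2) d1] fin fP by simp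
    moreover have "card (\<Union>P - {a, b}) + 1 = card P"
    proof -
      have "card (\<Union>P - {a, b}) = card (\<Union>P) - 2"
        using edge_path_ends[OF P(4)] P(3) by (subst card_Diff_subset) auto
      moreover have "0 < card P" using fP edge_path_nonempty[OF P(4)] by (simp add: card_gt_0_iff)
      ultimately show ?thesis using edge_path_card[OF P(4)] by simp
    qed
    moreover have "card ?C1 = card F + card P" "card ?C2 = card G + card P" "card C = card F + card G"
    proof -
      have "finite F" "finite G" "F \<inter> P = {}" "G \<inter> P = {}" "F \<inter> G = {}"
        using FG FP GP edge_path_finite unfolding cycle_arcs_def by auto
      then show "card ?C1 = card F + card P" "card ?C2 = card G + card P" "card C = card F + card G"
        using fP C by (auto intro: card_Un_disjoint)
    qed
    ultimately show ?thesis using IH m by linarith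
  qed
qed

text \<open>The new cycle \<open>G \<union> P\<close> is split by \<open>F\<close> into two cycles, one of which is the old one.\<close>

lemma theta_enlarge:
  assumes FG: "cycle_arcs E F G a b" and FP: "cycle_arcs E F P a b" and GP: "cycle_arcs E G P a b"
    and P: "drawn P \<inter> inside (drawn (F \<union> G)) = {}" and F: "drawn F \<inter> inside (drawn (G \<union> P)) \<noteq> {}"
  shows "(F \<union> G) \<union> inner_edges (F \<union> G) \<subset> (G \<union> P) \<union> inner_edges (G \<union> P)"
proof -
  have "F \<union> inner_edges (G \<union> F) \<union> inner_edges (P \<union> F) = inner_edges (G \<union> P)"
    using theta_inner_edges[OF GP cycle_arcs_swap[OF FG] cycle_arcs_swap[OF FP] F] .
  then have "(F \<union> G) \<union> inner_edges (F \<union> G) \<subseteq> (G \<union> P) \<union> inner_edges (G \<union> P)"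
    by (auto simp: Un_commute)
  moreover obtain e where e: "e \<in> P"
    using edge_path_nonempty FP unfolding cycle_arcs_def by blast
  have "e \<notin> inner_edges (F \<union> G)"
  proof
    assume "e \<in> inner_edges (F \<union> G)"
    then have "e \<in> E" "open_arc e \<subseteq> inside (drawn (F \<union> G))" unfolding inner_edges_def by auto
    then show False using open_arc_nonempty open_arc_subset_drawn[OF e] P by blast
  qed
  moreover have "e \<notin> F \<union> G" using e FP GP unfolding cycle_arcs_def by auto
  ultimately show ?thesis using e by blast
qed

text \<open>A cycle with as many edges as possible on it or inside it will do: an edge outside would
  yield an ear outside, and the ear together with one of the two parts of the cycle between its
  ends would enclose the other part.\<close>

lemma outer_cycle:
  assumes ns: "\<not> separable V E" and cyc: "is_cycle E C0"
  obtains C where "is_cycle E C" "E = C \<union> inner_edges C"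
proof -
  let ?size = "\<lambda>C. card (C \<union> inner_edges C)"
  have sub: "C \<union> inner_edges C \<subseteq> E" if "is_cycle E C" for C
    using is_cycle_subset[OF that] unfolding inner_edges_def by auto
  then have "\<forall>C. is_cycle E C \<longrightarrow> ?size C \<le> card E" using card_mono[OF finite_E] by blast
  then obtain C where C: "is_cycle E C" and max: "\<And>D. is_cycle E D \<Longrightarrow> ?size D \<le> ?size C"
    using ex_has_greatest_nat[of "is_cycle E" C0 ?size "Suc (card E)"] cyc
    by (metis less_Suc_eq_le)
  have grow: False if "is_cycle E D" "C \<union> inner_edges C \<subset> D \<union> inner_edges D" for D
    using max[OF that(1)] psubset_card_mono[OF finite_subset[OF sub[OF that(1)] finite_E] that(2)]
    by simp
  have "E \<subseteq> C \<union> inner_edges C"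
  proof (rule ccontr)
    assume "\<not> ?thesis"
    then obtain f where f: "f \<in> E" "f \<notin> C" "f \<notin> inner_edges C" by auto
    then obtain a b P where P: "a \<in> \<Union>C" "b \<in> \<Union>C" "a \<noteq> b" "edge_path E a P b" "P \<inter> C = {}"
      "\<Union>P \<inter> \<Union>C = {a, b}" "drawn P \<inter> inside (drawn C) = {}"
      using ear_on_side[OF ns C f(1,2)] by metis
    obtain F G where FG: "C = F \<union> G" "cycle_arcs E F G a b"
      using is_cycle_arcs[OF C P(1-3)] by metis
    have FP: "cycle_arcs E F P a b" and GP: "cycle_arcs E G P a b"
      using ear_cycle_arcs[OF FG(2) P(4)] ear_cycle_arcs[OF cycle_arcs_swap[OF FG(2)] P(4)] P(5,6) FG(1)
      by (simp_all add: Un_commute)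
    have out: "drawn P \<inter> inside (drawn (F \<union> G)) = {}" using P(7) FG(1) by simp
    from theta_some_path_inside[OF FG(2) FP GP out] show False
    proof
      assume "drawn F \<inter> inside (drawn (G \<union> P)) \<noteq> {}"
      then show False
        using grow[OF is_cycleI[OF GP]] theta_enlarge[OF FG(2) FP GP out] FG(1) by simp
    next
      assume "drawn G \<inter> inside (drawn (F \<union> P)) \<noteq> {}"
      then show False
        using grow[OF is_cycleI[OF FP]] theta_enlarge[OF cycle_arcs_swap[OF FG(2)] GP FP] out FG(1)
        by (simp add: Un_commute)
    qed
  qed
  then show ?thesis using that C sub by blast
qed

text \<open>The two ends of an edge play the role of the cycle: an ear with these ends closes up with the
  edge.\<close>

lemma nonseparable_cycle_exists:
  assumes ns: "\<not> separable V E" and n: "3 \<le> card V" and e: "e \<in> E"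
  shows "\<exists>C. is_cycle E C"
proof -
  obtain u v where uv: "e = {u, v}" "u \<noteq> v" using edge_card[OF e] by (auto simp: card_2_iff)
  have "\<not> V \<subseteq> e" using card_mono[of e V] n edge_card[OF e] uv by auto
  then obtain x where x: "x \<in> V" "x \<notin> e" by auto
  obtain a b P where P: "a \<in> e" "b \<in> e" "a \<noteq> b" "edge_path E a P b"
    "\<Union>P \<subseteq> linked_avoiding E e x \<union> {a, b}" "{a, b} \<notin> P"
    using nonseparable_ear[OF simple ns edge_subset[OF e] _ x] edge_card[OF e] by auto
  have "e = {a, b}" using P(1-3) uv by auto
  then have "edge_path E a {{a, b}} b" "{{a, b}} \<inter> P = {}"
    using edge_path.single[of a b E] e P(3,6) by auto
  moreover have "\<Union>{{a, b}} \<inter> \<Union>P = {a, b}" using edge_path_ends[OF P(4)] by auto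
  ultimately show ?thesis using P(4) is_cycleI unfolding cycle_arcs_def by metis
qed

text \<open>With all other edges inside \<open>C\<close>, twice the number of edges is at most
  \<open>3 * card C + 4 * n - 4\<close> for \<open>n\<close> inner vertices. As \<open>C\<close> has at least four edges, this is at most
  \<open>4 * (card C + n) - 8\<close>.\<close>

lemma nonseparable_triangle_free_edges:
  assumes ns: "\<not> separable V E" and tf: "triangle_free E" and n: "3 \<le> card V"
  shows "card E + 4 \<le> 2 * card V"
proof (cases "E = {}")
  case True
  then show ?thesis using n by simp
next
  case False
  then obtain C where C: "is_cycle E C" "E = C \<union> inner_edges C"
    using nonseparable_cycle_exists[OF ns n] outer_cycle[OF ns] by (metis ex_in_conv)
  have CE: "C \<subseteq> E" using is_cycle_subset[OF C(1)] .
  have UC: "\<Union>C \<subseteq> V" by (intro Union_least edge_subset) (use CE in auto)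
  have "card E \<le> card C + card (inner_edges C)" using C(2) card_Un_le by metis
  moreover have "card C + card (inner_vertices C) \<le> card V"
  proof -
    have "\<Union>C \<inter> inner_vertices C = {}"
      using p_in_drawn_iff[OF CE] inside_no_overlap[of "drawn C"]
      unfolding inner_vertices_def by blast
    moreover have "finite (\<Union>C)" "finite (inner_vertices C)" "\<Union>C \<union> inner_vertices C \<subseteq> V"
      using finite_V finite_subset[OF UC] UC unfolding inner_vertices_def by auto
    ultimately have "card (\<Union>C) + card (inner_vertices C) \<le> card V"
      using card_Un_disjoint[of "\<Union>C" "inner_vertices C"] card_mono[OF finite_V] by metis
    then show ?thesis using is_cycle_card_vertices[OF C(1)] by simp
  qed
  ultimately show ?thesis
    using inner_edges_bound[OF ns tf C(1)] triangle_free_cycle_card[OF C(1) tf] by linarith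
qed

end

section \<open>Planar graphs without triangles\<close>

lemma planar_subgraph:
  assumes "planar V E" "V' \<subseteq> V" "E' \<subseteq> E" "\<And>e. e \<in> E' \<Longrightarrow> e \<subseteq> V'"
  shows "planar V' E'"
proof -
  obtain p \<gamma> where d: "plane_drawing V E p \<gamma>" using assms(1) unfolding planar_def by auto
  have "path_image (\<gamma> e) \<inter> p ` V' = p ` e" if "e \<in> E'" for e
  proof -
    have "e \<in> E" using that assms(3) by auto
    then have "path_image (\<gamma> e) \<inter> p ` V = p ` e" using d unfolding plane_drawing_def by simp
    then have "path_image (\<gamma> e) \<inter> p ` V' = p ` e \<inter> p ` V'"
      using image_mono[OF assms(2)] by (metis Int_absorb1 Int_assoc)
    then show ?thesis using assms(4)[OF that] by auto
  qed
  moreover have "inj_on p V" using d unfolding plane_drawing_def by simp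
  then have "inj_on p V'" using assms(2) by (rule inj_on_subset)
  ultimately have "plane_drawing V' E' p \<gamma>"
    using d subsetD[OF assms(3)] unfolding plane_drawing_def by simp
  then show ?thesis unfolding planar_def by auto
qed

text \<open>If two parts with \<open>a\<close> and \<open>b\<close> vertices share at most one vertex, then \<open>a + b \<le> n + 1\<close>, and
  already the weaker bounds \<open>2 * a - 3\<close> and \<open>2 * b - 3\<close> for the parts add up to at most
  \<open>2 * n - 4\<close>.\<close>

theorem planar_triangle_free_edges:
  assumes "simple_graph V E" "planar V E" "triangle_free E" "3 \<le> card V"
  shows "card E + 4 \<le> 2 * card V"
  using assms
proof (induction "card V" arbitrary: V E rule: less_induct)
  case less
  have fV: "finite V" and edge: "\<And>e. e \<in> E \<Longrightarrow> e \<subseteq> V \<and> card e = 2"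
    using less.prems(1) unfolding simple_graph_def by auto
  have fE: "finite E" using finite_subset[of E "Pow V"] edge fV by auto
  show ?case
  proof (cases "separable V E")
    case False
    obtain p \<gamma> where "plane_drawing V E p \<gamma>" using less.prems(2) unfolding planar_def by auto
    then interpret plane_graph V E p \<gamma> using less.prems(1) by unfold_locales
    show ?thesis using nonseparable_triangle_free_edges[OF False less.prems(3,4)] .
  next
    case True
    then obtain A B where AB: "A \<union> B = V" "card (A \<inter> B) \<le> 1" "2 \<le> card A" "2 \<le> card B"
      "\<forall>e\<in>E. e \<subseteq> A \<or> e \<subseteq> B"
      unfolding separable_def by blast
    have fin: "finite A" "finite B" using AB(1) fV by auto
    have sum: "card A + card B \<le> card V + 1"
      using card_Un_Int[OF fin] AB(1,2) by simp
    \<comment> \<open>A part with two vertices has at most one edge, which this bound still allows.\<close>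
    have part: "card {e \<in> E. e \<subseteq> D} + 3 \<le> 2 * card D"
      if D: "D \<subseteq> V" "2 \<le> card D" "card D < card V" for D
    proof (cases "card D = 2")
      case True
      have "{e \<in> E. e \<subseteq> D} \<subseteq> {D}"
        using edge True finite_subset[OF D(1) fV] card_subset_eq[of D] by auto
      then have "card {e \<in> E. e \<subseteq> D} \<le> 1" using card_mono[of "{D}"] by fastforce
      then show ?thesis using True by simp
    next
      case False
      let ?F = "{e \<in> E. e \<subseteq> D}"
      have "simple_graph D ?F"
        using edge finite_subset[OF D(1) fV] unfolding simple_graph_def by auto
      moreover have "planar D ?F" by (rule planar_subgraph[OF less.prems(2) D(1)]) auto
      moreover have "triangle_free ?F" using less.prems(3) unfolding triangle_free_def by auto
      moreover have "3 \<le> card D" using D(2) False by simp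
      ultimately have "card ?F + 4 \<le> 2 * card D" by (rule less.hyps[OF D(3)])
      then show ?thesis by simp
    qed
    have "E = {e \<in> E. e \<subseteq> A} \<union> {e \<in> E. e \<subseteq> B}" using AB(5) by auto
    then have "card E \<le> card {e \<in> E. e \<subseteq> A} + card {e \<in> E. e \<subseteq> B}" using card_Un_le by metis
    then show ?thesis using part[of A] part[of B] AB(1,3,4) sum by auto
  qed
qed

section \<open>Independent sets\<close>

text \<open>The edges between \<open>I\<close> and the other vertices form a bipartite graph, in which each vertex
  of \<open>I\<close> has lost fewer than \<open>j\<close> neighbours.\<close>

lemma j_independent_edge_count:
  assumes G: "simple_graph V E" and I: "j_independent V E j I" and j: "j \<le> min_degree V E"
  shows "(min_degree V E - j + 1) * card I \<le> card {e \<in> E. card (e \<inter> I) = 1}"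
proof -
  let ?B = "{e \<in> E. card (e \<inter> I) = 1}"
  have fV: "finite V" and edge: "\<And>e. e \<in> E \<Longrightarrow> e \<subseteq> V \<and> card e = 2"
    using G unfolding simple_graph_def by auto
  have fE: "finite E" using finite_subset[of E "Pow V"] edge fV by auto
  have IV: "I \<subseteq> V" and max: "max_degree I (induced_edges E I) < j"
    using I unfolding j_independent_def by auto
  have fI: "finite I" using finite_subset[OF IV fV] .
  have deg: "min_degree V E - j + 1 \<le> card {e \<in> ?B. v \<in> e}" if v: "v \<in> I" for v
  proof -
    have "min_degree V E \<le> card {e \<in> E. v \<in> e}"
      using v IV fV unfolding min_degree_def vertex_degree_def by (intro Min_le) auto
    also have "{e \<in> E. v \<in> e} = {e \<in> ?B. v \<in> e} \<union> {e \<in> induced_edges E I. v \<in> e}"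
    proof -
      have "card (e \<inter> I) = 1 \<or> e \<subseteq> I" if e: "e \<in> E" "v \<in> e" for e
      proof -
        obtain w where w: "e = {v, w}" using edge[OF e(1)] e(2) by (auto simp: card_2_iff)
        then show ?thesis using v by (cases "w \<in> I") auto
      qed
      then show ?thesis unfolding induced_edges_def by auto
    qed
    also have "card \<dots> \<le> card {e \<in> ?B. v \<in> e} + card {e \<in> induced_edges E I. v \<in> e}"
      by (rule card_Un_le)
    also have "card {e \<in> induced_edges E I. v \<in> e} \<le> max_degree I (induced_edges E I)"
      using v fI unfolding max_degree_def vertex_degree_def by (intro Max_ge) auto
    finally show ?thesis using max j by linarith
  qed
  have "(min_degree V E - j + 1) * card I = (\<Sum>v\<in>I. min_degree V E - j + 1)" by simp
  also have "\<dots> \<le> (\<Sum>v\<in>I. card {e \<in> ?B. v \<in> e})" using deg by (rule sum_mono)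
  also have "\<dots> = (\<Sum>e\<in>?B. card {v \<in> I. v \<in> e})"
    using sum_multicount_gen[of I ?B "\<lambda>v e. v \<in> e" "\<lambda>e. card {v \<in> I. v \<in> e}"] fI fE by simp
  also have "\<dots> = (\<Sum>e\<in>?B. 1)"
    by (rule sum.cong) (auto simp: Int_def conj_commute)
  finally show ?thesis by simp
qed

theorem theorem4p4:
  fixes V :: "'a set" and E :: "'a set set" and j :: nat
  assumes "simple_graph V E"
    and "maximum_planar V E"
    and "min_degree V E \<le> 5"
    and "0 < j" and "j \<le> min_degree V E"
  shows "real (j_independence_number j V E)
           \<le> (2 * real (card V) - 4) / (real (min_degree V E) - real j + 1)"
proof -
  have fV: "finite V" and edge: "\<And>e. e \<in> E \<Longrightarrow> e \<subseteq> V \<and> card e = 2"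
    using assms(1) unfolding simple_graph_def by auto
  have fE: "finite E" using finite_subset[of E "Pow V"] edge fV by auto
  have planar: "planar V E" and m: "int (card E) = 3 * int (card V) - 6"
    using assms(2) unfolding maximum_planar_def by auto
  \<comment> \<open>Two vertices would have no edge between them, and then minimum degree 0.\<close>
  have n: "3 \<le> card V"
  proof (rule ccontr)
    assume "\<not> 3 \<le> card V"
    then have c: "card V = 2" "card E = 0" using m by auto
    then have "E = {}" using fE by simp
    moreover have "V \<noteq> {}" using c by auto
    ultimately have "vertex_degree E ` V = {0}" unfolding vertex_degree_def by auto
    then have "min_degree V E = 0" unfolding min_degree_def by simp
    then show False using assms(4,5) by simp
  qed
  let ?S = "{I. j_independent V E j I}"
  have "finite ?S" using finite_subset[of ?S "Pow V"] fV unfolding j_independent_def by auto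
  moreover have "{} \<in> ?S" using assms(4) unfolding j_independent_def max_degree_def by simp
  ultimately have "j_independence_number j V E \<in> card ` ?S"
    unfolding j_independence_number_def by (intro Max_in) auto
  then obtain I where I: "j_independent V E j I" "j_independence_number j V E = card I" by auto
  let ?B = "{e \<in> E. card (e \<inter> I) = 1}"
  have "triangle_free ?B"
    unfolding triangle_free_def
  proof (intro allI notI)
    fix a b c assume "{a, b} \<in> ?B \<and> {b, c} \<in> ?B \<and> {a, c} \<in> ?B"
    then have "a \<noteq> b" "b \<noteq> c" "a \<noteq> c" and
      "card ({a, b} \<inter> I) = 1" "card ({b, c} \<inter> I) = 1" "card ({a, c} \<inter> I) = 1"
      using edge by force+
    then show False by (cases "a \<in> I"; cases "b \<in> I"; cases "c \<in> I") auto
  qed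
  moreover have "simple_graph V ?B" using fV edge unfolding simple_graph_def by auto
  moreover have "planar V ?B"
    by (rule planar_subgraph[OF planar order_refl]) (auto dest!: edge)
  ultimately have "card ?B + 4 \<le> 2 * card V" using planar_triangle_free_edges n by blast
  then have "(min_degree V E - j + 1) * card I + 4 \<le> 2 * card V"
    using j_independent_edge_count[OF assms(1) I(1) assms(5)] by linarith
  then have "real ((min_degree V E - j + 1) * card I + 4) \<le> real (2 * card V)"
    by (simp only: of_nat_le_iff)
  then have "real (card I) * (real (min_degree V E) - real j + 1) \<le> 2 * real (card V) - 4"
    using assms(5) by (simp add: of_nat_diff of_nat_mult distrib_right distrib_left mult.commute)
  moreover have "0 < real (min_degree V E) - real j + 1" using assms(5) by simp
  ultimately show ?thesis using I(2) by (simp add: pos_le_divide_eq)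
qed

end
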